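(* Let $\mathbf C$ be an IT-category with terminal object $\mathcal Z$, let $\mathcal D,\mathcal U,\mathcal R$ be objects of $\mathbf C$, let $f:\mathcal Z\to\mathcal D$ be a (prior) distribution, and let $\gg_f$ be a preorder on the set of morphisms $h:\mathcal Z\to\mathcal D\times\mathcal U$ with $\pi_{\mathcal D,\mathcal U}\circ h=f$. Let $a:\mathcal D\to\mathcal R$ be a fixed morphism, let $b:\mathcal R\to\mathcal D$ be a conditional information transformer for $(i_{\mathcal D}*a)\circ f$ with respect to $\mathcal R$, and put $g=a\circ f$. Then the set of optimal decision strategies $r:\mathcal R\to\mathcal U$ for $f$ over $a\circ f$ coincides with the set of optimal decision strategies for $b\circ g$ over $g$: $$\mathrm{Opt}_f(a\circ f)=\mathrm{Opt}_{b\circ g}(g).$$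
   Context: A category of information transformers (IT-category) is a category $\mathbf C$ (composition $\circ$, identities $i_{\mathcal A}$) such that: (1) there is a fixed subcategory $\mathbf D$ (of deterministic ITs) containing all objects of $\mathbf C$; (2) the isomorphisms of $\mathbf C$ and of $\mathbf D$ coincide; (3) $\mathbf C$ and $\mathbf D$ have a common terminal object $\mathcal Z$; (4) $\mathbf D$ has (chosen) pairwise products $\mathcal A\times\mathcal B$ with projections $\pi_{\mathcal A,\mathcal B}:\mathcal A\times\mathcal B\to\mathcal A$, $\nu_{\mathcal A,\mathcal B}:\mathcal A\times\mathcal B\to\mathcal B$; for $a:\mathcal D\to\mathcal A$, $b:\mathcal D\to\mathcal B$ in $\mathbf D$ the induced morphism is denoted $a*b:\mathcal D\to\mathcal A\times\mathcal B$; (5) the operation $*$ is extended (by specified structure) to all pairs of morphisms $a:\mathcal D\to\mathcal A$, $b:\mathcal D\to\mathcal B$ of $\mathbf C$, so that $\pi_{\mathcal A,\mathcal B}\circ(a*b)=a$ and $\nu_{\mathcal A,\mathcal B}\circ(a*b)=b$ (uniqueness is not required in $\mathbf C$); (6) for $a:\mathcal A\to\mathcal C$, $b:\mathcal B\to\mathcal E$ in $\mathbf C$, with $a\times b:=(a\circ\pi_{\mathcal A,\mathcal B})*(b\circ\nu_{\mathcal A,\mathcal B})$, one has $(a\times b)\circ(c*d)=(a\circ c)*(b\circ d)$ for all $c:\mathcal D\to\mathcal A$, $d:\mathcal D\to\mathcal B$ in $\mathbf C$; (7) with $\sigma_{\mathcal A,\mathcal B}:=\nu_{\mathcal A,\mathcal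 B}*\pi_{\mathcal A,\mathcal B}$, one has $\sigma_{\mathcal A,\mathcal B}\circ(a*b)=b*a$ in $\mathbf C$; (8) with $\alpha_{\mathcal A,\mathcal B,\mathcal C}:=(\pi_{\mathcal A,\mathcal B}\circ\pi_{\mathcal A\times\mathcal B,\mathcal C})*\bigl((\nu_{\mathcal A,\mathcal B}\circ\pi_{\mathcal A\times\mathcal B,\mathcal C})*\nu_{\mathcal A\times\mathcal B,\mathcal C}\bigr)$, one has $\alpha_{\mathcal A,\mathcal B,\mathcal C}\circ((a*b)*c)=a*(b*c)$ in $\mathbf C$. A distribution on an object $\mathcal A$ is a morphism $\mathcal Z\to\mathcal A$ of $\mathbf C$. For a joint distribution $h:\mathcal Z\to\mathcal A\times\mathcal B$, a morphism $b:\mathcal B\to\mathcal A$ is a conditional IT for $h$ with respect to $\mathcal B$ if $h=(b*i_{\mathcal B})\circ\nu_{\mathcal A,\mathcal B}\circ h$. Optimality: $\mathrm{Opt}_f(a\circ f)$ is the set of $r:\mathcal R\to\mathcal U$ such that the distribution $(i_{\mathcal D}*(r\circ a))\circ f$ (of signal and decision) is maximal with respect to $\gg_f$ among the distributions $(i_{\mathcal D}*(r'\circ a))\circ f$, $r':\mathcal R\to\mathcal U$. Likewise $\mathrm{Opt}_{b\circ g}(g)$ is the set of $r:\mathcal R\to\mathcal U$ such that the joint distribution $(b*r)\circ g$ of the signal (with distribution $b\circ g$) and the decision $r\circ g$ is maximal among the distributions $(b*r')\circ g$, $r':\mathcal R\to\mathcal U$, with respect to the preorder $\gg_{b\circ g}$,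 i.e. the given preorder $\gg_f$ for the prior $f=b\circ g$ (the equality $b\circ g=f$ holds because $b$ is conditional for $(i_{\mathcal D}*a)\circ f$). *)

theory Defs
  imports Main
begin

section \<open>Categories\<close>

record ('o, 'm) cat =
  ob :: "'o set"
  arr :: "'m set"
  dom :: "'m \<Rightarrow> 'o"
  cod :: "'m \<Rightarrow> 'o"
  ide :: "'o \<Rightarrow> 'm"  (\<open>\<i>\<index>\<close>)
  comp :: "'m \<Rightarrow> 'm \<Rightarrow> 'm"  (infixr \<open>\<cdot>\<index>\<close> 75)

text \<open>
  The definitions relative to a set \<open>M\<close> of arrows serve both the whole category
  (\<open>M = arr C\<close>) and wide subcategories of it.
\<close>

definition hom_in :: "('o, 'm, 'x) cat_scheme \<Rightarrow> 'm set \<Rightarrow> 'o \<Rightarrow> 'o \<Rightarrow> 'm set"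
  where "hom_in C M A B = {f \<in> M. dom C f = A \<and> cod C f = B}"

abbreviation hom :: "('o, 'm, 'x) cat_scheme \<Rightarrow> 'o \<Rightarrow> 'o \<Rightarrow> 'm set"
  where "hom C A B \<equiv> hom_in C (arr C) A B"

locale category =
  fixes C :: "('o, 'm, 'x) cat_scheme" (structure)
  assumes dom_ob: "f \<in> arr C \<Longrightarrow> dom C f \<in> ob C"
    and cod_ob: "f \<in> arr C \<Longrightarrow> cod C f \<in> ob C"
    and ide_hom: "A \<in> ob C \<Longrightarrow> \<i> A \<in> hom C A A"
    and comp_hom: "\<lbrakk>f \<in> hom C A B; g \<in> hom C B E\<rbrakk> \<Longrightarrow> g \<cdot> f \<in> hom C A E"
    and ide_left: "f \<in> hom C A B \<Longrightarrow> \<i> B \<cdot> f = f"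
    and ide_right: "f \<in> hom C A B \<Longrightarrow> f \<cdot> \<i> A = f"
    and comp_assoc:
      "\<lbrakk>f \<in> hom C A B; g \<in> hom C B E; h \<in> hom C E F\<rbrakk> \<Longrightarrow> (h \<cdot> g) \<cdot> f = h \<cdot> (g \<cdot> f)"

definition isos_in :: "('o, 'm, 'x) cat_scheme \<Rightarrow> 'm set \<Rightarrow> 'm set"
  where "isos_in C M =
    {f \<in> M. \<exists>g \<in> hom_in C M (cod C f) (dom C f).
       comp C g f = ide C (dom C f) \<and> comp C f g = ide C (cod C f)}"

definition terminal_in :: "('o, 'm, 'x) cat_scheme \<Rightarrow> 'm set \<Rightarrow> 'o \<Rightarrow> bool"
  where "terminal_in C M Z \<longleftrightarrow> Z \<in> ob C \<and> (\<forall>A \<in> ob C. \<exists>!t. t \<in> hom_in C M A Z)"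


section \<open>Categories of information transformers\<close>

text \<open>
  \<open>det C\<close> is the set of arrows of the subcategory of deterministic ITs (it contains all
  objects, so the arrows determine it). The single operation \<open>star\<close> is both the pairing of
  the products in that subcategory and its extension to arbitrary arrows with common domain;
  its values on arrows with different domains are irrelevant.
\<close>

record ('o, 'm) it_cat = "('o, 'm) cat" +
  det :: "'m set"
  trm :: "'o"  (\<open>\<Z>\<index>\<close>)
  prd :: "'o \<Rightarrow> 'o \<Rightarrow> 'o"  (infixr \<open>\<otimes>\<index>\<close> 70)
  prj1 :: "'o \<Rightarrow> 'o \<Rightarrow> 'm"  (\<open>\<pi>\<index>\<close>)
  prj2 :: "'o \<Rightarrow> 'o \<Rightarrow> 'm"  (\<open>\<nu>\<index>\<close>)
  star :: "'m \<Rightarrow> 'm \<Rightarrow> 'm"  (infix \<open>\<star>\<index>\<close> 65)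

definition times_it :: "('o, 'm, 'x) it_cat_scheme \<Rightarrow> 'm \<Rightarrow> 'm \<Rightarrow> 'm"
  where "times_it C a b =
    star C (comp C a (prj1 C (dom C a) (dom C b))) (comp C b (prj2 C (dom C a) (dom C b)))"

definition swap_it :: "('o, 'm, 'x) it_cat_scheme \<Rightarrow> 'o \<Rightarrow> 'o \<Rightarrow> 'm"
  where "swap_it C A B = star C (prj2 C A B) (prj1 C A B)"

definition assoc_it :: "('o, 'm, 'x) it_cat_scheme \<Rightarrow> 'o \<Rightarrow> 'o \<Rightarrow> 'o \<Rightarrow> 'm"
  where "assoc_it C A B E =
    star C (comp C (prj1 C A B) (prj1 C (prd C A B) E))
      (star C (comp C (prj2 C A B) (prj1 C (prd C A B) E)) (prj2 C (prd C A B) E))"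

locale it_category = category C
  for C :: "('o, 'm, 'x) it_cat_scheme" (structure) +
  assumes det_arr: "det C \<subseteq> arr C"
    and det_ide: "A \<in> ob C \<Longrightarrow> \<i> A \<in> det C"
    and det_comp: "\<lbrakk>f \<in> hom_in C (det C) A B; g \<in> hom_in C (det C) B E\<rbrakk> \<Longrightarrow> g \<cdot> f \<in> det C"
    and isos_eq: "isos_in C (arr C) = isos_in C (det C)"
    and terminal_all: "terminal_in C (arr C) \<Z>"
    and terminal_det: "terminal_in C (det C) \<Z>"
    and prd_ob: "\<lbrakk>A \<in> ob C; B \<in> ob C\<rbrakk> \<Longrightarrow> A \<otimes> B \<in> ob C"
    and prj1_det: "\<lbrakk>A \<in> ob C; B \<in> ob C\<rbrakk> \<Longrightarrow> \<pi> A B \<in> hom_in C (det C) (A \<otimes> B) A"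
    and prj2_det: "\<lbrakk>A \<in> ob C; B \<in> ob C\<rbrakk> \<Longrightarrow> \<nu> A B \<in> hom_in C (det C) (A \<otimes> B) B"
    and star_det:
      "\<lbrakk>a \<in> hom_in C (det C) D A; b \<in> hom_in C (det C) D B\<rbrakk> \<Longrightarrow> a \<star> b \<in> det C"
    and star_unique:
      "\<lbrakk>a \<in> hom_in C (det C) D A; b \<in> hom_in C (det C) D B;
        h \<in> hom_in C (det C) D (A \<otimes> B); \<pi> A B \<cdot> h = a; \<nu> A B \<cdot> h = b\<rbrakk> \<Longrightarrow> h = a \<star> b"
    and star_hom: "\<lbrakk>a \<in> hom C D A; b \<in> hom C D B\<rbrakk> \<Longrightarrow> a \<star> b \<in> hom C D (A \<otimes> B)"
    and prj1_star: "\<lbrakk>a \<in> hom C D A; b \<in> hom C D B\<rbrakk> \<Longrightarrow> \<pi> A B \<cdot> (a \<star> b) = a"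
    and prj2_star: "\<lbrakk>a \<in> hom C D A; b \<in> hom C D B\<rbrakk> \<Longrightarrow> \<nu> A B \<cdot> (a \<star> b) = b"
    and times_star:
      "\<lbrakk>a \<in> hom C A E; b \<in> hom C B F; c \<in> hom C D A; d \<in> hom C D B\<rbrakk>
        \<Longrightarrow> times_it C a b \<cdot> (c \<star> d) = (a \<cdot> c) \<star> (b \<cdot> d)"
    and swap_star: "\<lbrakk>a \<in> hom C D A; b \<in> hom C D B\<rbrakk> \<Longrightarrow> swap_it C A B \<cdot> (a \<star> b) = b \<star> a"
    and assoc_star:
      "\<lbrakk>a \<in> hom C D A; b \<in> hom C D B; c \<in> hom C D E\<rbrakk>
        \<Longrightarrow> assoc_it C A B E \<cdot> ((a \<star> b) \<star> c) = a \<star> (b \<star> c)"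


section \<open>Distributions and conditional information transformers\<close>

definition dist :: "('o, 'm, 'x) it_cat_scheme \<Rightarrow> 'o \<Rightarrow> 'm set"
  where "dist C A = hom C (trm C) A"

definition conditional_it :: "('o, 'm, 'x) it_cat_scheme \<Rightarrow> 'o \<Rightarrow> 'o \<Rightarrow> 'm \<Rightarrow> 'm \<Rightarrow> bool"
  where "conditional_it C A B h b \<longleftrightarrow>
    h \<in> dist C (prd C A B) \<and> b \<in> hom C B A \<and>
    h = comp C (star C b (ide C B)) (comp C (prj2 C A B) h)"


section \<open>Optimal decision strategies\<close>

definition joint_dist_prior :: "('o, 'm, 'x) it_cat_scheme \<Rightarrow> 'o \<Rightarrow> 'o \<Rightarrow> 'm \<Rightarrow> 'm set"
  where "joint_dist_prior C D U f = {h \<in> dist C (prd C D U). comp C (prj1 C D U) h = f}"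

text \<open>
  \<open>(x, y) \<in> r\<close> reads \<open>x \<ggreater> y\<close>, i.e. \<open>x\<close> is at least as good as \<open>y\<close>. As \<open>r\<close> need not be
  antisymmetric, maximality means that nothing in \<open>S\<close> is strictly better.
\<close>

definition maximal_in :: "'m rel \<Rightarrow> 'm set \<Rightarrow> 'm \<Rightarrow> bool"
  where "maximal_in r S x \<longleftrightarrow> x \<in> S \<and> (\<forall>y \<in> S. (y, x) \<in> r \<longrightarrow> (x, y) \<in> r)"

text \<open>
  Below \<open>P\<close> assigns to each prior the relation comparing joint distributions with that prior.
  \<open>opt_prior C P D R U f a\<close> is the set written \<open>Opt\<^sub>f (a \<circ> f)\<close>: the prior \<open>f\<close> is given and the
  observation is made through \<open>a\<close>. \<open>opt_posterior C P R U b g\<close> is \<open>Opt\<^bsub>b \<circ> g\<^esub> (g)\<close>: the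
  distribution \<open>g\<close> of the observation is given, \<open>b\<close> recovers the signal from it, and the
  prior is \<open>b \<circ> g\<close>.
\<close>

definition opt_prior ::
    "('o, 'm, 'x) it_cat_scheme \<Rightarrow> ('m \<Rightarrow> 'm rel) \<Rightarrow> 'o \<Rightarrow> 'o \<Rightarrow> 'o \<Rightarrow> 'm \<Rightarrow> 'm \<Rightarrow> 'm set"
  where "opt_prior C P D R U f a =
    {r \<in> hom C R U.
       maximal_in (P f)
         {comp C (star C (ide C D) (comp C r' a)) f | r'. r' \<in> hom C R U}
         (comp C (star C (ide C D) (comp C r a)) f)}"

definition opt_posterior ::
    "('o, 'm, 'x) it_cat_scheme \<Rightarrow> ('m \<Rightarrow> 'm rel) \<Rightarrow> 'o \<Rightarrow> 'o \<Rightarrow> 'm \<Rightarrow> 'm \<Rightarrow> 'm set"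
  where "opt_posterior C P R U b g =
    {r \<in> hom C R U.
       maximal_in (P (comp C b g))
         {comp C (star C b r') g | r'. r' \<in> hom C R U}
         (comp C (star C b r) g)}"

end

theory Submission
  imports Defs
begin

text \<open>
  Since \<open>i\<^sub>D \<star> (r \<cdot> a) = (i\<^sub>D \<times> r) \<cdot> (i\<^sub>D \<star> a)\<close> and \<open>b \<star> r = (i\<^sub>D \<times> r) \<cdot> (b \<star> i\<^sub>R)\<close>, applying
  \<open>i\<^sub>D \<times> r\<close> to both sides of the conditionality equation
  \<open>(i\<^sub>D \<star> a) \<cdot> f = (b \<star> i\<^sub>R) \<cdot> g\<close> shows that every strategy yields the same joint distribution in
  both problems. Applying \<open>\<pi>\<close> instead gives \<open>f = b \<cdot> g\<close>, so the two preorders agree as well.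
\<close>

context it_category
begin

lemma ob_of_hom:
  assumes "f \<in> hom C A B"
  shows "A \<in> ob C" and "B \<in> ob C"
  using assms dom_ob cod_ob by (auto simp: hom_in_def)

lemma prj1_hom: "\<lbrakk>A \<in> ob C; B \<in> ob C\<rbrakk> \<Longrightarrow> \<pi> A B \<in> hom C (A \<otimes> B) A"
  using prj1_det det_arr by (auto simp: hom_in_def)

lemma prj2_hom: "\<lbrakk>A \<in> ob C; B \<in> ob C\<rbrakk> \<Longrightarrow> \<nu> A B \<in> hom C (A \<otimes> B) B"
  using prj2_det det_arr by (auto simp: hom_in_def)

lemma times_it_hom:
  assumes a: "a \<in> hom C A E" and b: "b \<in> hom C B F"
  shows "times_it C a b \<in> hom C (A \<otimes> B) (E \<otimes> F)"
proof -
  \<comment> \<open>\<open>times_it\<close> takes the indices of its projections from the domains of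
    its arguments.\<close>
  have "dom C a = A" "dom C b = B"
    using a b by (auto simp: hom_in_def)
  then show ?thesis
    unfolding times_it_def
    using star_hom[OF comp_hom[OF prj1_hom a] comp_hom[OF prj2_hom b]] a b ob_of_hom by auto
qed

text \<open>Interchange (\<open>times_star\<close>) precomposed with \<open>p\<close>; below,
  \<open>p\<close> is the prior \<open>f\<close> or the observation distribution
  \<open>a \<cdot> f\<close>.\<close>

lemma times_it_star_comp:
  assumes "a \<in> hom C A E" and "b \<in> hom C B F"
    and "c \<in> hom C X A" and "d \<in> hom C X B" and "p \<in> hom C W X"
  shows "times_it C a b \<cdot> ((c \<star> d) \<cdot> p) = ((a \<cdot> c) \<star> (b \<cdot> d)) \<cdot> p"
  using comp_assoc[OF assms(5) star_hom[OF assms(3,4)] times_it_hom[OF assms(1,2)]]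
    times_star[OF assms(1-4)] by simp

lemma prj1_star_comp:
  assumes "a \<in> hom C X A" and "b \<in> hom C X B" and "p \<in> hom C W X"
  shows "\<pi> A B \<cdot> ((a \<star> b) \<cdot> p) = a \<cdot> p"
  using comp_assoc[OF assms(3) star_hom[OF assms(1,2)] prj1_hom]
    prj1_star[OF assms(1,2)] ob_of_hom assms(1,2) by metis

lemma prj2_star_comp:
  assumes "a \<in> hom C X A" and "b \<in> hom C X B" and "p \<in> hom C W X"
  shows "\<nu> A B \<cdot> ((a \<star> b) \<cdot> p) = b \<cdot> p"
  using comp_assoc[OF assms(3) star_hom[OF assms(1,2)] prj2_hom]
    prj2_star[OF assms(1,2)] ob_of_hom assms(1,2) by metis

text \<open>The second marginal of \<open>(\<i> D \<star> a) \<cdot> f\<close> is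
  \<open>a \<cdot> f\<close>, which replaces the factor \<open>\<nu> D R \<cdot> h\<close> in the
  definition of conditionality.\<close>

lemma conditional_it_star_eq:
  assumes "f \<in> dist C D" and "a \<in> hom C D R"
    and "conditional_it C D R ((\<i> D \<star> a) \<cdot> f) b"
  shows "(\<i> D \<star> a) \<cdot> f = (b \<star> \<i> R) \<cdot> (a \<cdot> f)"
  using assms prj2_star_comp[OF ide_hom assms(2)] ob_of_hom(1)[OF assms(2)]
  unfolding conditional_it_def dist_def by metis

lemma conditional_it_prior:
  assumes f: "f \<in> dist C D" and a: "a \<in> hom C D R"
    and cond: "conditional_it C D R ((\<i> D \<star> a) \<cdot> f) b"
  shows "b \<cdot> (a \<cdot> f) = f"
proof -
  have f': "f \<in> hom C \<Z> D" and b: "b \<in> hom C R D"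
    using f cond by (auto simp: dist_def conditional_it_def)
  have "b \<cdot> (a \<cdot> f) = \<pi> D R \<cdot> ((b \<star> \<i> R) \<cdot> (a \<cdot> f))"
    using prj1_star_comp[OF b ide_hom comp_hom[OF f' a]] ob_of_hom(2)[OF a] by simp
  also have "\<dots> = \<pi> D R \<cdot> ((\<i> D \<star> a) \<cdot> f)"
    by (simp only: conditional_it_star_eq[OF f a cond])
  also have "\<dots> = \<i> D \<cdot> f"
    using prj1_star_comp[OF ide_hom a f'] ob_of_hom(1)[OF a] by simp
  also have "\<dots> = f"
    by (rule ide_left[OF f'])
  finally show ?thesis .
qed

lemma conditional_it_joint_dist:
  assumes f: "f \<in> dist C D" and a: "a \<in> hom C D R"
    and cond: "conditional_it C D R ((\<i> D \<star> a) \<cdot> f) b"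
    and r: "r \<in> hom C R U"
  shows "(\<i> D \<star> (r \<cdot> a)) \<cdot> f = (b \<star> r) \<cdot> (a \<cdot> f)"
proof -
  have f': "f \<in> hom C \<Z> D" and b: "b \<in> hom C R D"
    using f cond by (auto simp: dist_def conditional_it_def)
  have iD: "\<i> D \<in> hom C D D" and iR: "\<i> R \<in> hom C R R"
    using ide_hom ob_of_hom[OF a] by auto
  \<comment> \<open>The decision is postprocessing: \<open>r\<close> acts on the observation and the
    signal is kept.\<close>
  have "(\<i> D \<star> (r \<cdot> a)) \<cdot> f = times_it C (\<i> D) r \<cdot> ((\<i> D \<star> a) \<cdot> f)"
    using times_it_star_comp[OF iD r iD a f'] ide_left[OF iD] by simp
  also have "\<dots> = times_it C (\<i> D) r \<cdot> ((b \<star> \<i> R) \<cdot> (a \<cdot> f))"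
    by (simp only: conditional_it_star_eq[OF f a cond])
  also have "\<dots> = (b \<star> r) \<cdot> (a \<cdot> f)"
    using times_it_star_comp[OF iD r b iR comp_hom[OF f' a]] ide_left[OF b] ide_right[OF r]
    by simp
  finally show ?thesis .
qed

end

theorem theorem8p5:
  fixes C :: "('o, 'm, 'x) it_cat_scheme" (structure)
    and P :: "'m \<Rightarrow> 'm rel"
  assumes "it_category C"
    and "D \<in> ob C" and "U \<in> ob C" and "R \<in> ob C"
    and "f \<in> dist C D"
    and "preorder_on (joint_dist_prior C D U f) (P f)"
    and "a \<in> hom C D R"
    and "conditional_it C D R ((\<i> D \<star> a) \<cdot> f) b"
    and "g = a \<cdot> f"
  shows "opt_prior C P D R U f a = opt_posterior C P R U b g"
proof -
  interpret it_category C by fact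
  have prior: "b \<cdot> g = f"
    using conditional_it_prior assms by simp
  have joint: "(\<i> D \<star> (r \<cdot> a)) \<cdot> f = (b \<star> r) \<cdot> g" if "r \<in> hom C R U" for r
    using conditional_it_joint_dist assms that by simp
  \<comment> \<open>Maximality also depends on the set of competitors, so the two sets of attainable
    distributions must agree.\<close>
  have "{(\<i> D \<star> (r \<cdot> a)) \<cdot> f | r. r \<in> hom C R U} = {(b \<star> r) \<cdot> g | r. r \<in> hom C R U}"
    using joint by (metis (no_types, lifting))
  with prior joint show ?thesis
    unfolding opt_prior_def opt_posterior_def by auto
qed

end
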